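(* Let $K\ge2$, $0<v_1<\dots<v_K$, let $x^*$ be the aggregated market and $\beta\in[0,1]$. The set $\mathcal S'$ contains the first-degree price discrimination point $Q=\big(0,\ \sum_{k=1}^K x^*(v_k)v_k\big)$ if and only if $$\beta\ \le\ \min_{k:\,x^*(v_k)>0}\bar\beta_k .$$
   Context: $[K]=\{1,\dots,K\}$; $\mathcal V=\{v_1,\dots,v_K\}$; a market is a probability distribution $x$ on $\mathcal V$; $\mathcal X$ is the simplex of all markets, $\mathrm{Unif}(\mathcal X)$ the uniform distribution on it; $x^*\in\mathcal X$. For a price $p\ge0$ and market $x$: $\mathcal U_p(p,x)=p\sum_k x(v_k)\mathbf 1(p\le v_k)$ and $\mathcal U_c(p,x)=\sum_k x(v_k)(v_k-p)\mathbf 1(p\le v_k)$. For an observed market $\hat x$ put $\pi_\beta(\cdot|\hat x)=(1-\beta)\delta_{\hat x}+\beta\,\mathrm{Unif}(\mathcal X)$, $\mathcal U_p(p|\hat x)=\mathbb E_{x\sim\pi_\beta(\cdot|\hat x)}[\mathcal U_p(p,x)]$, and $$\mathcal X_i^\beta=\{\hat x\in\mathcal X:\ \mathcal U_p(v_i|\hat x)\ge\mathcal U_p(v_j|\hat x)\ \text{for all } j\in[K]\}.$$ $\mathcal S'$ is the set of all vectors $\big(\sum_{k=1}^K\gamma_k\,\mathcal U_c(v_k,x_k),\ \sum_{k=1}^K\gamma_k\,\mathcal U_p(v_k,x_k)\big)$ where $\gamma_k\in[0,1]$, $\sum_k\gamma_k=1$, $\sum_k\gamma_kx_k=x^*$,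 and $x_k\in\mathcal X_k^\beta$ for every $k$ with $\gamma_k>0$ (terms with $\gamma_k=0$ are dropped). For $i\in[K]$, $\bar\beta_i\in(0,1]$ is the unique solution of $$\frac{\bar\beta_i}{1-\bar\beta_i}=\min_{j\in[K]}\frac{K\big(v_i-\mathbf 1(j<i)v_j\big)}{\big[(K+1-j)v_j-(K+1-i)v_i\big]_+},$$ where $[z]_+=\max\{z,0\}$, a positive number divided by $0$ is $+\infty$, and $\bar\beta_i=1$ if the right-hand side is $+\infty$. *)

theory Defs
  imports "HOL-Probability.Probability"
begin

text \<open>
  The values are \<open>v 1, \<dots>, v K\<close>. A market is a probability vector indexed by the set of
  values, encoded as a function that is extensional on that set.
\<close>

definition value_set :: "nat \<Rightarrow> (nat \<Rightarrow> real) \<Rightarrow> real set" where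
  "value_set K v = v ` {1..K}"

definition markets :: "nat \<Rightarrow> (nat \<Rightarrow> real) \<Rightarrow> (real \<Rightarrow> real) set" where
  "markets K v =
     {x \<in> value_set K v \<rightarrow>\<^sub>E UNIV. (\<forall>w\<in>value_set K v. 0 \<le> x w) \<and> (\<Sum>w\<in>value_set K v. x w) = 1}"

definition market_space :: "nat \<Rightarrow> (nat \<Rightarrow> real) \<Rightarrow> (real \<Rightarrow> real) measure" where
  "market_space K v = PiM (value_set K v) (\<lambda>_. borel)"

text \<open>
  The simplex is a Lebesgue null set of its ambient space. Normalised surface measure on it is the
  image of normalised Lebesgue measure under the affine chart given by all coordinates but the
  last; an affine chart has constant Jacobian, so the choice of omitted coordinate is immaterial.
\<close>

definition solid_simplex :: "'i set \<Rightarrow> ('i \<Rightarrow> real) set" where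
  "solid_simplex I = {y \<in> I \<rightarrow>\<^sub>E UNIV. (\<forall>i\<in>I. 0 \<le> y i) \<and> (\<Sum>i\<in>I. y i) \<le> 1}"

definition uniform_market :: "nat \<Rightarrow> (nat \<Rightarrow> real) \<Rightarrow> (real \<Rightarrow> real) measure" where
  "uniform_market K v =
     (let I = v ` {1..<K} in
      distr (uniform_measure (PiM I (\<lambda>_. lborel)) (solid_simplex I)) (market_space K v)
        (\<lambda>y. y(v K := 1 - (\<Sum>w\<in>I. y w))))"

definition producer_utility :: "nat \<Rightarrow> (nat \<Rightarrow> real) \<Rightarrow> real \<Rightarrow> (real \<Rightarrow> real) \<Rightarrow> real" where
  "producer_utility K v p x = p * (\<Sum>k=1..K. x (v k) * of_bool (p \<le> v k))"

definition consumer_utility :: "nat \<Rightarrow> (nat \<Rightarrow> real) \<Rightarrow> real \<Rightarrow> (real \<Rightarrow> real) \<Rightarrow> real" where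
  "consumer_utility K v p x = (\<Sum>k=1..K. x (v k) * (v k - p) * of_bool (p \<le> v k))"

text \<open>
  The mixture \<open>(1 - \<beta>) \<delta>\<^sub>x + \<beta> Unif\<close>, written as a two-stage experiment: a coin that
  shows \<^term>\<open>True\<close> with probability \<open>\<beta>\<close> decides which component to sample from.
\<close>

definition posterior :: "nat \<Rightarrow> (nat \<Rightarrow> real) \<Rightarrow> real \<Rightarrow> (real \<Rightarrow> real) \<Rightarrow> (real \<Rightarrow> real) measure" where
  "posterior K v \<beta> xh =
     measure_pmf (bernoulli_pmf \<beta>) \<bind>
       (\<lambda>noise. if noise then uniform_market K v else return (market_space K v) xh)"

definition expected_producer_utility ::
    "nat \<Rightarrow> (nat \<Rightarrow> real) \<Rightarrow> real \<Rightarrow> real \<Rightarrow> (real \<Rightarrow> real) \<Rightarrow> real" where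
  "expected_producer_utility K v \<beta> p xh = (\<integral>x. producer_utility K v p x \<partial>posterior K v \<beta> xh)"

definition optimal_markets ::
    "nat \<Rightarrow> (nat \<Rightarrow> real) \<Rightarrow> real \<Rightarrow> nat \<Rightarrow> (real \<Rightarrow> real) set" where
  "optimal_markets K v \<beta> i =
     {xh \<in> markets K v. \<forall>j\<in>{1..K}.
        expected_producer_utility K v \<beta> (v i) xh \<ge> expected_producer_utility K v \<beta> (v j) xh}"

text \<open>
  Pairs (consumer utility, producer utility). Where \<open>\<gamma> k = 0\<close>, the market \<open>x k\<close> is
  arbitrary, and the factor \<open>\<gamma> k\<close> removes its terms from the sums.
\<close>

definition attainable_utilities ::
    "nat \<Rightarrow> (nat \<Rightarrow> real) \<Rightarrow> (real \<Rightarrow> real) \<Rightarrow> real \<Rightarrow> (real \<times> real) set" where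
  "attainable_utilities K v xs \<beta> =
     {(\<Sum>k=1..K. \<gamma> k * consumer_utility K v (v k) (x k),
       \<Sum>k=1..K. \<gamma> k * producer_utility K v (v k) (x k)) | \<gamma> x.
        (\<forall>k\<in>{1..K}. \<gamma> k \<in> {0..1}) \<and> (\<Sum>k=1..K. \<gamma> k) = 1 \<and>
        (\<forall>w\<in>value_set K v. (\<Sum>k=1..K. \<gamma> k * x k w) = xs w) \<and>
        (\<forall>k\<in>{1..K}. \<gamma> k > 0 \<longrightarrow> x k \<in> optimal_markets K v \<beta> k)}"

text \<open>
  In \<^typ>\<open>ereal\<close>, \<open>a / 0 = \<infinity>\<close> for \<open>a > 0\<close>. The numerators of the ratios are
  positive when the values are positive and increasing, and \<open>b / (1 - b) = \<infinity>\<close> for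
  \<open>b \<in> {0<..1}\<close> exactly when \<open>b = 1\<close>; an infinite minimum thus yields the threshold 1.
\<close>

definition threshold_ratio :: "nat \<Rightarrow> (nat \<Rightarrow> real) \<Rightarrow> nat \<Rightarrow> nat \<Rightarrow> ereal" where
  "threshold_ratio K v i j =
     ereal (real K * (v i - of_bool (j < i) * v j)) /
     ereal (max ((real K + 1 - real j) * v j - (real K + 1 - real i) * v i) 0)"

definition threshold :: "nat \<Rightarrow> (nat \<Rightarrow> real) \<Rightarrow> nat \<Rightarrow> real" where
  "threshold K v i =
     (THE b. b \<in> {0<..1} \<and>
        ereal b / ereal (1 - b) = Min ((\<lambda>j. threshold_ratio K v i j) ` {1..K}))"

end

theory Submission
  imports Defs
begin

text \<open>
  Replacing one coordinate of the solid simplex by the slack \<open>1 - \<Sum>\<close> preserves Lebesgue measure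
  and the simplex, so all coordinates and the slack have the same mean under the uniform
  distribution, namely \<open>1 / K\<close>; hence posting \<open>v j\<close> against a uniform market earns
  \<open>v j * (K + 1 - j) / K\<close> on average. Total surplus splits into consumer utility, producer utility
  and the surplus of buyers priced out, so full extraction forces every segment in use to be
  a point mass at its own price. It is therefore attainable iff each point mass at a value in the
  support of the aggregate market is optimal for that value, a linear inequality in \<open>\<beta>\<close> for each
  deviation; solving these for the odds \<open>\<beta> / (1 - \<beta>)\<close> gives the threshold.
\<close>

section \<open>Coordinate means on the solid simplex\<close>

lemma solid_simplex_sets [measurable]:
  assumes "finite I"
  shows "solid_simplex I \<in> sets (PiM I (\<lambda>_. lborel))"
proof -
  have "solid_simplex I = {y \<in> space (PiM I (\<lambda>_. lborel)). (\<forall>i\<in>I. 0 \<le> y i) \<and> (\<Sum>i\<in>I. y i) \<le> 1}"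
    by (simp add: solid_simplex_def space_PiM)
  also have "\<dots> \<in> sets (PiM I (\<lambda>_. lborel))"
    using assms by measurable
  finally show ?thesis .
qed

text \<open>The simplex lies in the unit cube. Finite and nonzero volume together make the
  normalised measure on it a probability measure.\<close>

lemma emeasure_solid_simplex_finite:
  assumes "finite I"
  shows "emeasure (PiM I (\<lambda>_. lborel)) (solid_simplex I) \<noteq> \<infinity>"
proof -
  interpret product_sigma_finite "\<lambda>_::'a. lborel :: real measure" ..
  have "y i \<le> 1" if "y \<in> solid_simplex I" "i \<in> I" for y i
    using that assms member_le_sum[of i I y] by (fastforce simp: solid_simplex_def)
  then have "solid_simplex I \<subseteq> (\<Pi>\<^sub>E i\<in>I. {0..1})"
    by (auto simp: solid_simplex_def)
  then have "emeasure (PiM I (\<lambda>_. lborel)) (solid_simplex I)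
      \<le> emeasure (PiM I (\<lambda>_. lborel)) (\<Pi>\<^sub>E i\<in>I. {0..1::real})"
    using assms by (intro emeasure_mono sets_PiM_I_finite) auto
  also have "\<dots> = 1"
    using assms by (subst emeasure_PiM) auto
  finally show ?thesis
    by (auto simp: top_unique)
qed

lemma emeasure_solid_simplex_nonzero:
  assumes "finite I"
  shows "emeasure (PiM I (\<lambda>_. lborel)) (solid_simplex I) \<noteq> 0"
proof -
  interpret product_sigma_finite "\<lambda>_::'a. lborel :: real measure" ..
  \<comment> \<open>A cube of side \<open>c\<close> has coordinate sums at most
    \<open>card I * c \<le> 1\<close>, so it fits inside the simplex. The added 1 keeps
    \<open>c\<close> positive even for empty \<open>I\<close>.\<close>
  define c where "c = 1 / (real (card I) + 1)"
  have "c > 0" by (simp add: c_def add_pos_nonneg)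
  have "(\<Sum>i\<in>I. y i) \<le> 1" if "y \<in> (\<Pi>\<^sub>E i\<in>I. {0..c})" for y
  proof -
    have "(\<Sum>i\<in>I. y i) \<le> real (card I) * c"
      using that by (intro sum_bounded_above) auto
    also have "\<dots> \<le> 1" by (simp add: c_def)
    finally show ?thesis .
  qed
  then have "(\<Pi>\<^sub>E i\<in>I. {0..c}) \<subseteq> solid_simplex I"
    by (auto simp: solid_simplex_def PiE_iff)
  then have "emeasure (PiM I (\<lambda>_. lborel)) (\<Pi>\<^sub>E i\<in>I. {0..c})
      \<le> emeasure (PiM I (\<lambda>_. lborel)) (solid_simplex I)"
    using assms by (intro emeasure_mono) auto
  moreover have "emeasure (PiM I (\<lambda>_. lborel)) (\<Pi>\<^sub>E i\<in>I. {0..c}) = ennreal (c ^ card I)"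
    using assms \<open>c > 0\<close> by (subst emeasure_PiM) (auto simp: ennreal_power)
  ultimately show ?thesis
    using \<open>c > 0\<close> by auto
qed

lemma prob_space_solid_simplex:
  "finite I \<Longrightarrow> prob_space (uniform_measure (PiM I (\<lambda>_. lborel)) (solid_simplex I))"
  by (intro prob_space_uniform_measure emeasure_solid_simplex_finite emeasure_solid_simplex_nonzero)

text \<open>In barycentric coordinates, with the slack as the additional one, this transposes
  coordinate \<open>i\<close> and the slack: for \<open>i\<close> in a finite \<open>I\<close> the
  sum still contains the old \<open>y i\<close>, which becomes the new slack.\<close>

definition slack_swap :: "'i set \<Rightarrow> 'i \<Rightarrow> ('i \<Rightarrow> real) \<Rightarrow> 'i \<Rightarrow> real" where
  "slack_swap I i y = y(i := 1 - (\<Sum>w\<in>I. y w))"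

lemma measurable_slack_swap [measurable]:
  assumes "finite I" "i \<in> I"
  shows "slack_swap I i \<in> PiM I (\<lambda>_. lborel) \<rightarrow>\<^sub>M PiM I (\<lambda>_. lborel)"
  unfolding slack_swap_def
  using assms by (intro measurable_fun_upd[where J = I]) auto

text \<open>Two constraints trade places: nonnegativity of the new coordinate \<open>i\<close> is
  the old bound on the sum, and the new bound on the sum is nonnegativity of the old
  \<open>y i\<close>.\<close>

lemma slack_swap_in_solid_simplex:
  assumes "finite I" "i \<in> I" "y \<in> I \<rightarrow>\<^sub>E UNIV"
  shows "slack_swap I i y \<in> solid_simplex I \<longleftrightarrow> y \<in> solid_simplex I"
proof -
  have "(\<Sum>w\<in>I. slack_swap I i y w) = 1 - y i"
    using assms(1,2) by (simp add: slack_swap_def sum.remove[of I i])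
  moreover have "(\<forall>w\<in>I. 0 \<le> slack_swap I i y w) \<longleftrightarrow>
      (\<forall>w\<in>I - {i}. 0 \<le> y w) \<and> (\<Sum>w\<in>I. y w) \<le> 1"
    using assms(2) by (auto simp: slack_swap_def)
  moreover have "slack_swap I i y \<in> I \<rightarrow>\<^sub>E UNIV"
    using assms(2,3) by (auto simp: slack_swap_def PiE_iff extensional_def)
  ultimately show ?thesis
    using assms(2,3) by (auto simp: solid_simplex_def)
qed

text \<open>
  With all other coordinates fixed, the swap acts on coordinate \<open>i\<close> as a reflection of the line.
\<close>

lemma nn_integral_slack_swap:
  fixes f :: "('i \<Rightarrow> real) \<Rightarrow> ennreal"
  assumes "finite I" "i \<in> I" and [measurable]: "f \<in> borel_measurable (PiM I (\<lambda>_. lborel))"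
  shows "(\<integral>\<^sup>+y. f (slack_swap I i y) \<partial>PiM I (\<lambda>_. lborel)) = (\<integral>\<^sup>+y. f y \<partial>PiM I (\<lambda>_. lborel))"
proof -
  interpret product_sigma_finite "\<lambda>_::'i. lborel :: real measure" ..
  define J where "J = I - {i}"
  have J: "finite J" "i \<notin> J" and I: "I = insert i J"
    using assms by (auto simp: J_def)
  have f: "f \<in> borel_measurable (PiM (insert i J) (\<lambda>_. lborel))"
    using assms(3) I by simp
  have fT: "(\<lambda>y. f (slack_swap I i y)) \<in> borel_measurable (PiM (insert i J) (\<lambda>_. lborel))"
    using measurable_compose[OF measurable_slack_swap[OF assms(1,2)] assms(3)] I by simp
  have *: "(\<integral>\<^sup>+t. f (slack_swap I i (y(i := t))) \<partial>lborel) = (\<integral>\<^sup>+t. f (y(i := t)) \<partial>lborel)"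
    if y: "y \<in> space (PiM J (\<lambda>_. lborel))" for y
  proof -
    have m: "(\<lambda>t. f (y(i := t))) \<in> borel_measurable borel"
    proof -
      have "(\<lambda>t. y(i := t)) \<in> lborel \<rightarrow>\<^sub>M PiM (insert i J) (\<lambda>_. lborel)"
        using y by (intro measurable_fun_upd[where J = J]) auto
      from measurable_compose[OF this f] show ?thesis by simp
    qed
    \<comment> \<open>The sum over \<open>J\<close> does not see \<open>t\<close>, so the new
      coordinate is affine in \<open>t\<close> with slope \<open>- 1\<close>. The substitution rule
      then contributes the factor \<open>|-1| = 1\<close>.\<close>
    have "slack_swap I i (y(i := t)) = y(i := (1 - (\<Sum>w\<in>J. y w)) + (- 1) * t)" for t
    proof -
      have "(\<Sum>w\<in>J. (y(i := t)) w) = (\<Sum>w\<in>J. y w)"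
        using J by (intro sum.cong) auto
      then show ?thesis
        using J by (simp add: slack_swap_def I algebra_simps)
    qed
    then show ?thesis
      using nn_integral_real_affine[OF m, of "- 1" "1 - (\<Sum>w\<in>J. y w)"] by simp
  qed
  show ?thesis
    \<comment> \<open>Integrating coordinate \<open>i\<close> innermost reduces the claim to the
      one-dimensional identity for each fixed choice of the other coordinates.\<close>
    unfolding I
    unfolding product_nn_integral_insert[OF J fT[unfolded I]] product_nn_integral_insert[OF J f]
    using * unfolding I by (rule nn_integral_cong)
qed

text \<open>The swap preserves both Lebesgue measure and the indicator of the simplex, hence also
  the normalised restriction.\<close>

lemma nn_integral_solid_simplex_slack_swap:
  fixes f :: "('i \<Rightarrow> real) \<Rightarrow> ennreal"
  assumes "finite I" "i \<in> I" and [measurable]: "f \<in> borel_measurable (PiM I (\<lambda>_. lborel))"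
  shows "(\<integral>\<^sup>+y. f (slack_swap I i y) \<partial>uniform_measure (PiM I (\<lambda>_. lborel)) (solid_simplex I))
    = (\<integral>\<^sup>+y. f y \<partial>uniform_measure (PiM I (\<lambda>_. lborel)) (solid_simplex I))"
proof -
  note [measurable] = measurable_slack_swap[OF assms(1,2)] solid_simplex_sets[OF assms(1)]
  have "(\<integral>\<^sup>+y. f y * indicator (solid_simplex I) y \<partial>PiM I (\<lambda>_. lborel)) =
      (\<integral>\<^sup>+y. f (slack_swap I i y) * indicator (solid_simplex I) (slack_swap I i y)
        \<partial>PiM I (\<lambda>_. lborel))"
    using assms by (subst nn_integral_slack_swap) auto
  also have "\<dots> = (\<integral>\<^sup>+y. f (slack_swap I i y) * indicator (solid_simplex I) y \<partial>PiM I (\<lambda>_. lborel))"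
    using slack_swap_in_solid_simplex[OF assms(1,2)]
    by (intro nn_integral_cong) (auto simp: space_PiM indicator_def)
  finally show ?thesis
    by (simp add: nn_integral_uniform_measure)
qed

lemma AE_solid_simplex:
  "finite I \<Longrightarrow> AE y in uniform_measure (PiM I (\<lambda>_. lborel)) (solid_simplex I). y \<in> solid_simplex I"
  by (intro AE_uniform_measureI) auto

lemma integrable_solid_simplex_coordinate:
  assumes "finite I" "i \<in> I"
  shows "integrable (uniform_measure (PiM I (\<lambda>_. lborel)) (solid_simplex I)) (\<lambda>y. y i)"
proof -
  interpret prob_space "uniform_measure (PiM I (\<lambda>_. lborel)) (solid_simplex I)"
    using prob_space_solid_simplex[OF assms(1)] .
  have "norm (y i) \<le> 1" if "y \<in> solid_simplex I" for y
    using that assms member_le_sum[of i I y] by (fastforce simp: solid_simplex_def)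
  then have "AE y in uniform_measure (PiM I (\<lambda>_. lborel)) (solid_simplex I). norm (y i) \<le> 1"
    using AE_solid_simplex[OF assms(1)] by (auto elim: eventually_mono)
  then show ?thesis
    using assms(2) by (intro integrable_const_bound) auto
qed

text \<open>The \<open>card I\<close> coordinates and the slack sum to 1 and, by the swap, share one
  mean \<open>m\<close>.\<close>

lemma expectation_solid_simplex_coordinate:
  assumes "finite I" "i \<in> I"
  shows "(\<integral>y. y i \<partial>uniform_measure (PiM I (\<lambda>_. lborel)) (solid_simplex I)) = 1 / (real (card I) + 1)"
proof -
  define U where "U = uniform_measure (PiM I (\<lambda>_. lborel :: real measure)) (solid_simplex I)"
  interpret prob_space U
    unfolding U_def using prob_space_solid_simplex[OF assms(1)] .
  define m where "m = (\<integral>y. 1 - (\<Sum>w\<in>I. y w) \<partial>U)"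
  have int: "integrable U (\<lambda>y. y j)" if "j \<in> I" for j
    unfolding U_def using integrable_solid_simplex_coordinate[OF assms(1) that] .
  have AE: "AE y in U. y \<in> solid_simplex I"
    unfolding U_def using AE_solid_simplex[OF assms(1)] .
  have coord: "(\<integral>y. y j \<partial>U) = m" if "j \<in> I" for j
  proof -
    \<comment> \<open>Invariance is available for nonnegative integrals; coordinates and slack are
      nonnegative almost everywhere on the simplex, so the passage there and back is exact.\<close>
    have "(\<integral>y. y j \<partial>U) = enn2real (\<integral>\<^sup>+y. ennreal (y j) \<partial>U)"
      using that AE by (intro integral_eq_nn_integral)
        (auto simp: U_def solid_simplex_def elim: eventually_mono)
    also have "(\<integral>\<^sup>+y. ennreal (y j) \<partial>U) = (\<integral>\<^sup>+y. ennreal (slack_swap I j y j) \<partial>U)"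
      unfolding U_def using that assms(1)
      by (subst nn_integral_solid_simplex_slack_swap) auto
    also have "enn2real \<dots> = m"
      unfolding m_def using AE by (subst integral_eq_nn_integral)
        (auto simp: U_def solid_simplex_def slack_swap_def elim: eventually_mono)
    finally show ?thesis .
  qed
  have "m = 1 - (\<Sum>w\<in>I. \<integral>y. y w \<partial>U)"
    unfolding m_def using int by (subst Bochner_Integration.integral_diff) (auto simp: prob_space)
  then have "m * (real (card I) + 1) = 1"
    by (simp add: coord algebra_simps)
  then show ?thesis
    using coord[OF assms(2)] by (simp add: U_def field_simps)
qed

section \<open>Expected producer utility\<close>

text \<open>The bind is evaluated with nonnegative integrals, which is why \<open>f\<close> has to
  be nonnegative almost everywhere under both components; integrability makes the values
  finite.\<close>

lemma integral_bind_bernoulli: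
  fixes f :: "'a \<Rightarrow> real"
  assumes p: "0 \<le> p" "p \<le> 1"
    and A: "A \<in> space (subprob_algebra N)" and B: "B \<in> space (subprob_algebra N)"
    and f [measurable]: "f \<in> borel_measurable N"
    and int: "integrable A f" "integrable B f"
    and nonneg: "AE x in A. 0 \<le> f x" "AE x in B. 0 \<le> f x"
  shows "(\<integral>x. f x \<partial>(measure_pmf (bernoulli_pmf p) \<bind> (\<lambda>b. if b then A else B))) =
    p * (\<integral>x. f x \<partial>A) + (1 - p) * (\<integral>x. f x \<partial>B)"
proof -
  let ?k = "\<lambda>b. if b then A else B"
  let ?M = "measure_pmf (bernoulli_pmf p) \<bind> ?k"
  have k: "?k \<in> measure_pmf (bernoulli_pmf p) \<rightarrow>\<^sub>M subprob_algebra N"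
    using A B by auto
  have sets: "sets ?M = sets N"
    using A B by (intro sets_bind) (auto simp: space_subprob_algebra)
  have "AE x in ?M. 0 \<le> f x"
    using nonneg by (subst AE_bind[OF k]) (auto intro!: AE_pmfI)
  then have "(\<integral>x. f x \<partial>?M) = enn2real (\<integral>\<^sup>+x. ennreal (f x) \<partial>?M)"
    using sets by (intro integral_eq_nn_integral) (auto cong: measurable_cong_sets)
  also have "(\<integral>\<^sup>+x. ennreal (f x) \<partial>?M) =
      (\<integral>\<^sup>+b. (\<integral>\<^sup>+x. ennreal (f x) \<partial>?k b) \<partial>measure_pmf (bernoulli_pmf p))"
    by (rule nn_integral_bind[OF _ k]) auto
  also have "\<dots> = ennreal (\<integral>x. f x \<partial>A) * ennreal p + ennreal (\<integral>x. f x \<partial>B) * ennreal (1 - p)"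
    using p by (subst nn_integral_bernoulli_pmf)
      (auto simp: nn_integral_eq_integral int nonneg)
  also have "\<dots> = ennreal (p * (\<integral>x. f x \<partial>A) + (1 - p) * (\<integral>x. f x \<partial>B))"
    using p nonneg by (simp add: ennreal_mult' ennreal_plus integral_nonneg_AE mult.commute)
  finally show ?thesis
    using p nonneg by (simp add: integral_nonneg_AE flip: ennreal_plus)
qed


section \<open>Ordered values and markets over them\<close>

lemma inj_on_values:
  fixes v :: "nat \<Rightarrow> real"
  assumes "strict_mono_on {1..K} v"
  shows "inj_on v {1..K}"
  using assms by (rule strict_mono_on_imp_inj_on)

lemma value_le_iff:
  fixes v :: "nat \<Rightarrow> real"
  assumes "strict_mono_on {1..K} v" "i \<in> {1..K}" "j \<in> {1..K}"
  shows "v i \<le> v j \<longleftrightarrow> i \<le> j"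
  using assms by (rule strict_mono_on_less_eq)

lemma value_pos:
  fixes v :: "nat \<Rightarrow> real"
  assumes "strict_mono_on {1..K} v" "0 < v 1" "i \<in> {1..K}"
  shows "0 < v i"
  using value_le_iff[OF assms(1), of 1 i] assms by fastforce

lemma sum_value_set:
  fixes v :: "nat \<Rightarrow> real"
  assumes "strict_mono_on {1..K} v"
  shows "(\<Sum>w\<in>value_set K v. f w) = (\<Sum>k=1..K. f (v k))"
  unfolding value_set_def using inj_on_values[OF assms] by (simp add: sum.reindex)

lemma marketsD:
  assumes "strict_mono_on {1..K} v" "x \<in> markets K v"
  shows "\<And>k. k \<in> {1..K} \<Longrightarrow> 0 \<le> x (v k)" "(\<Sum>k=1..K. x (v k)) = 1"
  using assms(2) sum_value_set[OF assms(1), of x] by (auto simp: markets_def value_set_def)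

lemma measurable_producer_utility [measurable]:
  "producer_utility K v p \<in> borel_measurable (market_space K v)"
proof -
  have "(\<lambda>x. x (v k)) \<in> borel_measurable (market_space K v)" if "k \<in> {1..K}" for k
    unfolding market_space_def using that
    by (intro measurable_component_singleton) (auto simp: value_set_def)
  then show ?thesis
    unfolding producer_utility_def[abs_def]
    by (intro borel_measurable_times borel_measurable_sum) auto
qed

section \<open>The uniform market through its chart\<close>

lemma last_coordinate_chart_measurable:
  assumes "K \<ge> 1"
  shows "(\<lambda>y. y(v K := 1 - (\<Sum>w\<in>v ` {1..<K}. y w))) \<in>
    uniform_measure (PiM (v ` {1..<K}) (\<lambda>_. lborel)) (solid_simplex (v ` {1..<K})) \<rightarrow>\<^sub>M market_space K v"
proof -
  have "value_set K v = v ` {1..<K} \<union> {v K}"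
    using assms by (auto simp: value_set_def atLeastLessThanSuc_atLeastAtMost[symmetric] less_Suc_eq_le le_less)
  then have "(\<lambda>y. y(v K := 1 - (\<Sum>w\<in>v ` {1..<K}. y w))) \<in>
      PiM (v ` {1..<K}) (\<lambda>_. borel) \<rightarrow>\<^sub>M market_space K v"
    unfolding market_space_def by (intro measurable_fun_upd) auto
  moreover have "sets (PiM (v ` {1..<K}) (\<lambda>_. lborel :: real measure)) = sets (PiM (v ` {1..<K}) (\<lambda>_. borel))"
    by (intro sets_PiM_cong) auto
  ultimately show ?thesis
    by (simp cong: measurable_cong_sets)
qed

lemma prob_space_uniform_market:
  assumes "K \<ge> 1"
  shows "prob_space (uniform_market K v)"
  unfolding uniform_market_def Let_def
  by (intro prob_space.prob_space_distr prob_space_solid_simplex last_coordinate_chart_measurable assms) auto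

text \<open>The chart has \<open>K - 1\<close> free coordinates, each of mean \<open>1 / K\<close>;
  the coordinate at \<open>v K\<close> is the slack and has mean \<open>1 - (K - 1) / K\<close>, the
  same number.\<close>

lemma uniform_market_coordinate:
  assumes "K \<ge> 1" and v: "strict_mono_on {1..K} v" and k: "k \<in> {1..K}"
  shows "integrable (uniform_market K v) (\<lambda>x. x (v k))"
    and "(\<integral>x. x (v k) \<partial>uniform_market K v) = 1 / real K"
    and "AE x in uniform_market K v. 0 \<le> x (v k)"
proof -
  define I where "I = v ` {1..<K}"
  define U where "U = uniform_measure (PiM I (\<lambda>_. lborel)) (solid_simplex I)"
  define c where "c = (\<lambda>y::real\<Rightarrow>real. y(v K := 1 - (\<Sum>w\<in>I. y w)))"
  have I: "finite I" by (simp add: I_def)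
  interpret prob_space U
    unfolding U_def using prob_space_solid_simplex[OF I] .
  have UM: "uniform_market K v = distr U (market_space K v) c"
    by (simp add: uniform_market_def I_def U_def c_def)
  have c [measurable]: "c \<in> U \<rightarrow>\<^sub>M market_space K v"
    unfolding c_def U_def I_def by (rule last_coordinate_chart_measurable[OF assms(1)])
  have m [measurable]: "(\<lambda>x. x (v k)) \<in> borel_measurable (market_space K v)"
    unfolding market_space_def using k
    by (intro measurable_component_singleton) (auto simp: value_set_def)
  have inj: "inj_on v {1..K}"
    using inj_on_values[OF v] .
  have vK: "v K \<notin> I"
  proof
    assume "v K \<in> I"
    then obtain k where "k \<in> {1..<K}" "v K = v k" by (auto simp: I_def)
    with inj_onD[OF inj, of K k] show False by simp
  qed
  have "card I = K - 1"
    unfolding I_def by (subst card_image) (auto intro: inj_on_subset[OF inj])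
  then have card: "real (card I) + 1 = real K"
    using assms(1) by simp
  have int: "integrable U (\<lambda>y. y w)" and ex: "(\<integral>y. y w \<partial>U) = 1 / real K" if "w \<in> I" for w
    using integrable_solid_simplex_coordinate[OF I that]
      expectation_solid_simplex_coordinate[OF I that] card by (simp_all add: U_def)
  have AE: "AE y in U. y \<in> solid_simplex I"
    unfolding U_def using AE_solid_simplex[OF I] .
  \<comment> \<open>All three claims are pulled back along the chart \<open>c\<close>, where
    coordinate \<open>v k\<close> is either the slack or one of the free coordinates.\<close>
  have "integrable U (\<lambda>y. c y (v k)) \<and> (\<integral>y. c y (v k) \<partial>U) = 1 / real K \<and> (AE y in U. 0 \<le> c y (v k))"
  proof (cases "k = K")
    case True
    have "(\<integral>y. 1 - (\<Sum>w\<in>I. y w) \<partial>U) = 1 - real (card I) * (1 / real K)"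
      using int ex by (subst Bochner_Integration.integral_diff) (auto simp: prob_space)
    also have "\<dots> = 1 / real K"
      using card assms(1) by (simp add: field_simps)
    finally show ?thesis
      using True int AE by (auto simp: c_def solid_simplex_def elim: eventually_mono)
  next
    case False
    then have "v k \<in> I" using k by (auto simp: I_def)
    moreover from this vK have "v k \<noteq> v K" by metis
    ultimately show ?thesis
      using int ex AE by (auto simp: c_def solid_simplex_def elim: eventually_mono)
  qed
  then show "integrable (uniform_market K v) (\<lambda>x. x (v k))"
    and "(\<integral>x. x (v k) \<partial>uniform_market K v) = 1 / real K"
    and "AE x in uniform_market K v. 0 \<le> x (v k)"
    unfolding UM by (simp_all add: integrable_distr_eq integral_distr AE_distr_iff)
qed

section \<open>Producer utility under the noisy posterior\<close>

lemma producer_utility_nonneg: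
  assumes "0 \<le> p" "\<And>k. k \<in> {1..K} \<Longrightarrow> 0 \<le> x (v k)"
  shows "0 \<le> producer_utility K v p x"
  unfolding producer_utility_def using assms by (intro mult_nonneg_nonneg sum_nonneg) auto

lemma sum_of_bool_value_le:
  fixes v :: "nat \<Rightarrow> real"
  assumes "strict_mono_on {1..K} v" "j \<in> {1..K}"
  shows "(\<Sum>k=1..K. of_bool (v j \<le> v k)) = real K + 1 - real j"
proof -
  have "(\<Sum>k=1..K. of_bool (v j \<le> v k) :: real) = (\<Sum>k=1..K. of_bool (j \<le> k))"
    using value_le_iff[OF assms] by (intro sum.cong) auto
  also have "\<dots> = real (card {j..K})"
  proof -
    have "{1..K} \<inter> {k. j \<le> k} = {j..K}"
      using assms(2) by auto
    then show ?thesis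
      by (simp add: of_bool_def sum.If_cases)
  qed
  finally show ?thesis
    using assms(2) by (simp add: of_nat_diff)
qed

text \<open>Under uniform noise the price \<open>v j\<close> sells to the \<open>K + 1 - j\<close>
  values not below it, each of mean mass \<open>1 / K\<close>; the other component of the mixture is
  the observed market itself.\<close>

lemma expected_producer_utility_eq:
  assumes "K \<ge> 1" "0 < v 1" and v: "strict_mono_on {1..K} v" and "\<beta> \<in> {0..1}"
    and xh: "xh \<in> markets K v" and j: "j \<in> {1..K}"
  shows "expected_producer_utility K v \<beta> (v j) xh =
    \<beta> * (v j * (real K + 1 - real j) / real K) + (1 - \<beta>) * producer_utility K v (v j) xh"
proof -
  let ?N = "market_space K v" and ?U = "uniform_market K v"
  interpret U: prob_space ?U
    using prob_space_uniform_market[OF assms(1)] .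
  have setsU: "sets ?U = sets ?N"
    by (simp add: uniform_market_def Let_def)
  have xh_space: "xh \<in> space ?N"
    using xh by (auto simp: markets_def market_space_def space_PiM)
  interpret R: prob_space "return ?N xh"
    using prob_space_return[OF xh_space] .
  have pos: "0 \<le> v j"
    using value_pos[OF v assms(2) j] by simp
  have U_mean: "(\<integral>x. producer_utility K v (v j) x \<partial>?U) = v j * (real K + 1 - real j) / real K"
  proof -
    have "(\<integral>x. producer_utility K v (v j) x \<partial>?U) =
        v j * (\<Sum>k=1..K. 1 / real K * of_bool (v j \<le> v k))"
      unfolding producer_utility_def using uniform_market_coordinate[OF assms(1) v]
      by (simp add: Bochner_Integration.integral_sum del: sum_mult_of_bool_eq)
    also have "\<dots> = v j * (real K + 1 - real j) / real K"
      using sum_of_bool_value_le[OF v j] by (simp only: sum_distrib_left[symmetric]) simp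
    finally show ?thesis .
  qed
  have U_int: "integrable ?U (producer_utility K v (v j))"
    unfolding producer_utility_def[abs_def] using uniform_market_coordinate[OF assms(1) v]
    by (intro integrable_mult_right integrable_sum integrable_mult_left) auto
  have "AE x in ?U. \<forall>k\<in>{1..K}. 0 \<le> x (v k)"
    using uniform_market_coordinate(3)[OF assms(1) v] by (intro AE_finite_allI) auto
  then have U_nonneg: "AE x in ?U. 0 \<le> producer_utility K v (v j) x"
    by eventually_elim (intro producer_utility_nonneg pos, auto)
  have xh_nonneg: "0 \<le> producer_utility K v (v j) xh"
    using marketsD(1)[OF v xh] by (intro producer_utility_nonneg pos) auto
  \<comment> \<open>Under a point mass the utility is almost surely constant, which yields its
    integrability and its sign.\<close>
  have R_AE: "AE x in return ?N xh. producer_utility K v (v j) x = producer_utility K v (v j) xh"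
    using xh_space by (subst AE_return) auto
  have R_int: "integrable (return ?N xh) (producer_utility K v (v j))"
    using R_AE by (intro R.integrable_const_bound[where B = "norm (producer_utility K v (v j) xh)"])
      (auto elim: eventually_mono)
  have "expected_producer_utility K v \<beta> (v j) xh =
    \<beta> * (\<integral>x. producer_utility K v (v j) x \<partial>?U) +
    (1 - \<beta>) * (\<integral>x. producer_utility K v (v j) x \<partial>return ?N xh)"
    unfolding expected_producer_utility_def posterior_def
  proof (rule integral_bind_bernoulli[where N = ?N])
    show "?U \<in> space (subprob_algebra ?N)" "return ?N xh \<in> space (subprob_algebra ?N)"
      using setsU U.prob_space_axioms R.prob_space_axioms
      by (auto simp: space_subprob_algebra intro: prob_space_imp_subprob_space)
    show "AE x in return ?N xh. 0 \<le> producer_utility K v (v j) x"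
      using R_AE by eventually_elim (simp add: xh_nonneg)
    show "0 \<le> \<beta>" "\<beta> \<le> 1"
      using assms(4) by auto
  qed (rule U_int R_int U_nonneg measurable_producer_utility)+
  then show ?thesis
    using xh_space by (simp add: U_mean integral_return)
qed

section \<open>Thresholds\<close>

text \<open>Odds increase strictly on the unit interval. The endpoint 1 is treated separately: its
  quotient divides by zero and is infinite in \<open>ereal\<close>.\<close>

lemma odds_le_iff:
  assumes "a \<in> {0..1}" "b \<in> {0..1}"
  shows "ereal a / ereal (1 - a) \<le> ereal b / ereal (1 - b) \<longleftrightarrow> a \<le> b"
proof (cases "b = 1")
  case True
  then show ?thesis using assms by (simp add: zero_ereal_def[symmetric] divide_ereal_def)
next
  case False
  show ?thesis
  proof (cases "a = 1")
    case True
    with False assms show ?thesis by (simp add: divide_ereal_def)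
  next
    case a: False
    have "a / (1 - a) \<le> b / (1 - b) \<longleftrightarrow> a \<le> b"
      using a False assms by (simp add: field_simps)
    with a False assms show ?thesis by simp
  qed
qed

text \<open>The inverse of the odds is \<open>s / (1 + s)\<close> for finite \<open>s\<close>, and 1
  for \<open>\<infinity>\<close>.\<close>

lemma odds_surj:
  fixes r :: ereal
  assumes "0 < r"
  shows "\<exists>b\<in>{0<..1}. ereal b / ereal (1 - b) = r"
proof (cases r)
  case (real s)
  then have s: "0 < s" using assms by simp
  then have "s / (1 + s) \<in> {0<..1}" by (simp add: field_simps)
  moreover have "ereal (s / (1 + s)) / ereal (1 - s / (1 + s)) = r"
    using s real by (simp add: field_simps)
  ultimately show ?thesis by blast
next
  case PInf
  then show ?thesis by (intro bexI[of _ 1]) (auto simp: divide_ereal_def)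
qed (use assms in auto)

text \<open>This excludes \<open>0 / 0\<close>: a vanishing denominator always makes the ratio
  infinite.\<close>

lemma threshold_ratio_numerator_pos:
  fixes v :: "nat \<Rightarrow> real"
  assumes "0 < v 1" "strict_mono_on {1..K} v" "i \<in> {1..K}" "j \<in> {1..K}"
  shows "0 < v i - of_bool (j < i) * v j"
  using assms value_pos[of K v i] by (auto simp: strict_mono_on_def)

lemma ereal_divide_max_0_eq:
  fixes n d :: real
  assumes "0 < n"
  shows "ereal n / ereal (max d 0) = (if d \<le> 0 then \<infinity> else ereal (n / d))"
  using assms by (auto simp: max_def)

text \<open>Clearing denominators also removes the truncation: if the untruncated denominator is at
  most 0, the ratio is infinite and the linear inequality holds by signs alone.\<close>

lemma odds_le_threshold_ratio_iff:
  assumes "0 < v 1" "strict_mono_on {1..K} v" "i \<in> {1..K}" "j \<in> {1..K}" "\<beta> \<in> {0..1}"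
  shows "ereal \<beta> / ereal (1 - \<beta>) \<le> threshold_ratio K v i j \<longleftrightarrow>
    \<beta> * ((real K + 1 - real j) * v j - (real K + 1 - real i) * v i)
      \<le> (1 - \<beta>) * (real K * (v i - of_bool (j < i) * v j))"
proof -
  define n where "n = real K * (v i - of_bool (j < i) * v j)"
  define d where "d = (real K + 1 - real j) * v j - (real K + 1 - real i) * v i"
  have n: "n > 0"
    using threshold_ratio_numerator_pos[OF assms(1-4)] assms(3) by (simp add: n_def)
  have "ereal \<beta> / ereal (1 - \<beta>) \<le> (if d \<le> 0 then \<infinity> else ereal (n / d)) \<longleftrightarrow> \<beta> * d \<le> (1 - \<beta>) * n"
  proof (cases "d \<le> 0")
    case True
    then have "\<beta> * d \<le> 0" "0 \<le> (1 - \<beta>) * n"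
      using assms(5) n by (auto simp: mult_nonneg_nonpos)
    then show ?thesis using True by simp
  next
    case False
    show ?thesis
    \<comment> \<open>At \<open>\<beta> = 1\<close> both sides fail: infinite odds exceed the finite
      ratio, and the linear inequality would say \<open>d \<le> 0\<close>.\<close>
    proof (cases "\<beta> = 1")
      case True
      then show ?thesis using False by (simp add: divide_ereal_def)
    next
      case b: False
      then have "\<beta> < 1" using assms(5) by simp
      then show ?thesis using False by (simp add: field_simps)
    qed
  qed
  then show ?thesis
    unfolding threshold_ratio_def n_def[symmetric] d_def[symmetric] ereal_divide_max_0_eq[OF n] .
qed

lemma le_threshold_iff:
  assumes "0 < v 1" "strict_mono_on {1..K} v" "i \<in> {1..K}" "\<beta> \<in> {0..1}"
  shows "\<beta> \<le> threshold K v i \<longleftrightarrow> (\<forall>j\<in>{1..K}.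
    \<beta> * ((real K + 1 - real j) * v j - (real K + 1 - real i) * v i)
      \<le> (1 - \<beta>) * (real K * (v i - of_bool (j < i) * v j)))"
proof -
  define r where "r = Min (threshold_ratio K v i ` {1..K})"
  have ne: "{1..K} \<noteq> {}" using assms(3) by auto
  have "0 < threshold_ratio K v i j" if "j \<in> {1..K}" for j
  proof -
    have "0 < real K * (v i - of_bool (j < i) * v j)"
      using threshold_ratio_numerator_pos[OF assms(1-3) that] assms(3) by simp
    from ereal_divide_max_0_eq[OF this] this show ?thesis
      unfolding threshold_ratio_def by simp
  qed
  then have "0 < r"
    unfolding r_def using ne by (subst Min_gr_iff) auto
  \<comment> \<open>The definite description in \<open>threshold\<close> has content only after
    this. Existence needs the minimum to be positive; uniqueness is monotonicity of the
    odds.\<close>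
  have "\<exists>!b. b \<in> {0<..1} \<and> ereal b / ereal (1 - b) = r"
  proof (rule ex_ex1I)
    show "\<exists>b. b \<in> {0<..1} \<and> ereal b / ereal (1 - b) = r"
      using odds_surj[OF \<open>0 < r\<close>] by auto
    fix b c assume "b \<in> {0<..1} \<and> ereal b / ereal (1 - b) = r" "c \<in> {0<..1} \<and> ereal c / ereal (1 - c) = r"
    then show "b = c"
      using odds_le_iff[of b c] odds_le_iff[of c b] by auto
  qed
  from theI'[OF this] have t: "threshold K v i \<in> {0<..1}"
    "ereal (threshold K v i) / ereal (1 - threshold K v i) = r"
    unfolding threshold_def r_def by auto
  have "\<beta> \<le> threshold K v i \<longleftrightarrow> ereal \<beta> / ereal (1 - \<beta>) \<le> r"
    using odds_le_iff[OF assms(4), of "threshold K v i"] t by auto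
  also have "\<dots> \<longleftrightarrow> (\<forall>j\<in>{1..K}. ereal \<beta> / ereal (1 - \<beta>) \<le> threshold_ratio K v i j)"
    unfolding r_def using ne by (subst Min_ge_iff) auto
  finally show ?thesis
    using odds_le_threshold_ratio_iff[OF assms(1-3) _ assms(4)] by simp
qed

section \<open>Point markets\<close>

text \<open>The point mass at \<open>v i\<close>; the restricted abstraction makes it extensional,
  as \<open>markets\<close> requires.\<close>

definition point_market :: "nat \<Rightarrow> (nat \<Rightarrow> real) \<Rightarrow> nat \<Rightarrow> real \<Rightarrow> real" where
  "point_market K v i = (\<lambda>w\<in>value_set K v. of_bool (w = v i))"

lemma point_market_apply:
  assumes "strict_mono_on {1..K} v" "i \<in> {1..K}" "k \<in> {1..K}"
  shows "point_market K v i (v k) = of_bool (k = i)"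
  using inj_on_eq_iff[OF inj_on_values[OF assms(1)] assms(3,2)] assms(3)
  by (simp add: point_market_def value_set_def)

lemma point_market_in_markets:
  assumes "strict_mono_on {1..K} v" "i \<in> {1..K}"
  shows "point_market K v i \<in> markets K v"
  using assms(2) by (auto simp: markets_def point_market_def value_set_def of_bool_def)

lemma market_eq_point_market:
  assumes v: "strict_mono_on {1..K} v" and i: "i \<in> {1..K}" and x: "x \<in> markets K v"
    and zero: "\<And>k. k \<in> {1..K} \<Longrightarrow> k \<noteq> i \<Longrightarrow> x (v k) = 0"
  shows "x = point_market K v i"
proof (rule extensionalityI[where A = "value_set K v"])
  have "x (v i) = (\<Sum>k=1..K. x (v k))"
    using i zero by (subst sum.remove[of _ i]) auto
  then have "x (v i) = 1"
    using marketsD(2)[OF v x] by simp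
  then show "x w = point_market K v i w" if "w \<in> value_set K v" for w
    using that zero point_market_apply[OF v i] by (auto simp: value_set_def)
qed (use x in \<open>auto simp: markets_def point_market_def PiE_def\<close>)

lemma producer_utility_point_market:
  assumes "strict_mono_on {1..K} v" "i \<in> {1..K}" "j \<in> {1..K}"
  shows "producer_utility K v (v j) (point_market K v i) = of_bool (j \<le> i) * v j"
proof -
  have "(\<Sum>k=1..K. point_market K v i (v k) * of_bool (v j \<le> v k)) =
      (\<Sum>k=1..K. if k = i then of_bool (j \<le> i) else (0::real))"
    using assms point_market_apply[OF assms(1,2)] value_le_iff[OF assms(1)]
    by (intro sum.cong) auto
  then show ?thesis
    using assms(2) by (simp add: producer_utility_def)
qed

lemma consumer_utility_point_market:
  assumes "strict_mono_on {1..K} v" "i \<in> {1..K}"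
  shows "consumer_utility K v (v i) (point_market K v i) = 0"
  unfolding consumer_utility_def using point_market_apply[OF assms] by (intro sum.neutral) auto

text \<open>For each deviation \<open>j\<close>, the comparison of expected utilities at the point
  mass is exactly the linear inequality behind \<open>threshold_ratio K v i j\<close>.\<close>

lemma point_market_optimal_iff:
  assumes "K \<ge> 1" "0 < v 1" and v: "strict_mono_on {1..K} v" and "\<beta> \<in> {0..1}"
    and i: "i \<in> {1..K}"
  shows "point_market K v i \<in> optimal_markets K v \<beta> i \<longleftrightarrow> \<beta> \<le> threshold K v i"
proof -
  let ?E = "\<lambda>j. expected_producer_utility K v \<beta> (v j) (point_market K v i)"
  \<comment> \<open>Scaling by \<open>K\<close> clears the denominator of the uniform mean.\<close>
  have E: "real K * ?E j = \<beta> * ((real K + 1 - real j) * v j) + (1 - \<beta>) * (real K * (of_bool (j \<le> i) * v j))"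
    if "j \<in> {1..K}" for j
    unfolding expected_producer_utility_eq[OF assms(1-4) point_market_in_markets[OF v i] that]
      producer_utility_point_market[OF v i that]
    using assms(1) by (simp add: distrib_left mult.left_commute[of "real K"])
  have "?E j \<le> ?E i \<longleftrightarrow>
      \<beta> * ((real K + 1 - real j) * v j - (real K + 1 - real i) * v i)
        \<le> (1 - \<beta>) * (real K * (v i - of_bool (j < i) * v j))" if j: "j \<in> {1..K}" for j
  \<comment> \<open>The utility carries the indicator of \<open>j \<le> i\<close>, the ratio that of
    \<open>j < i\<close>. They differ only at \<open>j = i\<close>, where both sides of the
    equivalence are true.\<close>
  proof (cases "j = i")
    case True
    then show ?thesis
      using assms(4) value_pos[OF v assms(2) i] by simp
  next
    case False
    have "?E j \<le> ?E i \<longleftrightarrow> real K * ?E j \<le> real K * ?E i"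
      using assms(1) by (subst mult_le_cancel_left_pos) auto
    also have "\<dots> \<longleftrightarrow> \<beta> * ((real K + 1 - real j) * v j) +
        (1 - \<beta>) * (real K * (of_bool (j < i) * v j))
        \<le> \<beta> * ((real K + 1 - real i) * v i) + (1 - \<beta>) * (real K * v i)"
      using False by (simp only: E i j le_less) simp
    finally show ?thesis
      unfolding right_diff_distrib by linarith
  qed
  then show ?thesis
    using le_threshold_iff[OF assms(2) v i assms(4)] point_market_in_markets[OF v i]
    by (simp add: optimal_markets_def)
qed

section \<open>First-degree price discrimination\<close>

text \<open>
  The sum on the left is the surplus lost to buyers who are priced out.
\<close>

lemma lost_surplus_eq:
  "(\<Sum>k=1..K. x (v k) * v k * of_bool (v k < p)) =
    (\<Sum>k=1..K. x (v k) * v k) - consumer_utility K v p x - producer_utility K v p x"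
  unfolding consumer_utility_def producer_utility_def sum_distrib_left sum_subtractf[symmetric]
  by (intro sum.cong) (auto simp: algebra_simps)

text \<open>Zero consumer utility excludes mass above \<open>v i\<close>, zero lost surplus excludes
  mass below, since all terms of both sums are nonnegative.\<close>

lemma fully_extracted_market:
  assumes "0 < v 1" and v: "strict_mono_on {1..K} v" and i: "i \<in> {1..K}" and x: "x \<in> markets K v"
    and cons: "consumer_utility K v (v i) x = 0"
    and lost: "(\<Sum>k=1..K. x (v k) * v k * of_bool (v k < v i)) = 0"
  shows "x = point_market K v i"
proof (rule market_eq_point_market[OF v i x])
  fix k assume k: "k \<in> {1..K}" "k \<noteq> i"
  have nonneg: "0 \<le> x (v l)" "0 < v l" if "l \<in> {1..K}" for l
    using marketsD(1)[OF v x that] value_pos[OF v assms(1) that] .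
  have "x (v k) * (v k - v i) * of_bool (v i \<le> v k) = 0"
    using cons k nonneg unfolding consumer_utility_def
    by (subst (asm) sum_nonneg_eq_0_iff) auto
  moreover have "x (v k) * v k * of_bool (v k < v i) = 0"
  proof -
    have "0 \<le> x (v l) * v l * of_bool (v l < v i)" if "l \<in> {1..K}" for l
      using nonneg[OF that] by simp
    with lost k show ?thesis
      by (subst (asm) sum_nonneg_eq_0_iff) auto
  qed
  moreover have "v k \<noteq> v i"
    using k i inj_on_eq_iff[OF inj_on_values[OF v]] by simp
  ultimately show "x (v k) = 0"
    using nonneg(2)[OF k(1)] by (cases "v k < v i") auto
qed

lemma full_extraction_attainable_iff:
  assumes "K \<ge> 1" "0 < v 1" and v: "strict_mono_on {1..K} v" and xs: "xs \<in> markets K v"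
  shows "(0, \<Sum>k=1..K. xs (v k) * v k) \<in> attainable_utilities K v xs \<beta> \<longleftrightarrow>
    (\<forall>k\<in>{1..K}. xs (v k) > 0 \<longrightarrow> point_market K v k \<in> optimal_markets K v \<beta> k)"
proof
  assume "(0, \<Sum>k=1..K. xs (v k) * v k) \<in> attainable_utilities K v xs \<beta>"
  then obtain \<gamma> x where
    C: "(\<Sum>k=1..K. \<gamma> k * consumer_utility K v (v k) (x k)) = 0" and
    P: "(\<Sum>k=1..K. \<gamma> k * producer_utility K v (v k) (x k)) = (\<Sum>k=1..K. xs (v k) * v k)" and
    \<gamma>: "\<And>k. k \<in> {1..K} \<Longrightarrow> 0 \<le> \<gamma> k" and
    agg: "\<And>w. w \<in> value_set K v \<Longrightarrow> (\<Sum>k=1..K. \<gamma> k * x k w) = xs w" and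
    opt: "\<And>k. k \<in> {1..K} \<Longrightarrow> \<gamma> k > 0 \<Longrightarrow> x k \<in> optimal_markets K v \<beta> k"
    unfolding attainable_utilities_def by auto
  define D where "D l = (\<Sum>k=1..K. x l (v k) * v k * of_bool (v k < v l))" for l
  have D: "D l = (\<Sum>k=1..K. x l (v k) * v k) - consumer_utility K v (v l) (x l)
      - producer_utility K v (v l) (x l)" for l
    unfolding D_def by (rule lost_surplus_eq)
  \<comment> \<open>Total surplus is linear in the market, so it splits over the segments.\<close>
  have "(\<Sum>k=1..K. xs (v k) * v k) = (\<Sum>k=1..K. \<Sum>l=1..K. \<gamma> l * (x l (v k) * v k))"
  proof (intro sum.cong refl)
    fix k assume "k \<in> {1..K}"
    then show "xs (v k) * v k = (\<Sum>l=1..K. \<gamma> l * (x l (v k) * v k))"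
      using agg[of "v k", symmetric] by (simp add: value_set_def sum_distrib_right mult.assoc)
  qed
  also have "\<dots> = (\<Sum>l=1..K. \<gamma> l * (\<Sum>k=1..K. x l (v k) * v k))"
    by (subst sum.swap) (simp add: sum_distrib_left)
  \<comment> \<open>Consumers get 0 and the producer gets the entire surplus, so the weighted lost
    surplus is 0.\<close>
  finally have D0: "(\<Sum>l=1..K. \<gamma> l * D l) = 0"
    using C P by (simp add: D right_diff_distrib sum_subtractf)
  have mk: "x l \<in> markets K v" if "l \<in> {1..K}" "\<gamma> l > 0" for l
    using opt[OF that] by (simp add: optimal_markets_def)
  \<comment> \<open>A segment of weight 0 has an arbitrary \<open>x l\<close>, so signs are claimed
    only for the weighted terms.\<close>
  have nonneg: "0 \<le> \<gamma> l * D l" "0 \<le> \<gamma> l * consumer_utility K v (v l) (x l)" if l: "l \<in> {1..K}" for l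
  proof -
    have "0 \<le> D l \<and> 0 \<le> consumer_utility K v (v l) (x l)" if "\<gamma> l > 0"
    proof -
      have "0 \<le> x l (v k)" "0 \<le> v k" if "k \<in> {1..K}" for k
        using marketsD(1)[OF v mk[OF l \<open>\<gamma> l > 0\<close>] that] value_pos[OF v assms(2) that] by auto
      then show ?thesis
        unfolding D_def consumer_utility_def
        by (intro conjI sum_nonneg) (simp_all add: of_bool_def)
    qed
    then show "0 \<le> \<gamma> l * D l" "0 \<le> \<gamma> l * consumer_utility K v (v l) (x l)"
      using \<gamma>[OF l] by (cases "\<gamma> l = 0"; simp)+
  qed
  have point: "x l = point_market K v l" if l: "l \<in> {1..K}" "\<gamma> l > 0" for l
  proof (rule fully_extracted_market[OF assms(2) v l(1) mk[OF l]])
    have "\<gamma> l * consumer_utility K v (v l) (x l) = 0"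
      using sum_nonneg_0[OF _ nonneg(2) C l(1)] by simp
    then show "consumer_utility K v (v l) (x l) = 0" using l by simp
    have "\<gamma> l * D l = 0"
      using sum_nonneg_0[OF _ nonneg(1) D0 l(1)] by simp
    then show "(\<Sum>k=1..K. x l (v k) * v k * of_bool (v k < v l)) = 0"
      using l by (simp add: D_def)
  qed
  show "\<forall>k\<in>{1..K}. xs (v k) > 0 \<longrightarrow> point_market K v k \<in> optimal_markets K v \<beta> k"
  proof (intro ballI impI)
    fix k assume k: "k \<in> {1..K}" and "xs (v k) > 0"
    \<comment> \<open>Mass at \<open>v k\<close> must come from some segment \<open>l\<close> of
      positive weight; that segment is a point mass at \<open>v l\<close>, so
      \<open>l = k\<close>.\<close>
    then have "(\<Sum>l=1..K. \<gamma> l * x l (v k)) \<noteq> 0"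
      using agg[of "v k"] by (auto simp: value_set_def)
    then obtain l where l: "l \<in> {1..K}" "\<gamma> l * x l (v k) \<noteq> 0"
      by (meson sum.neutral)
    then have "\<gamma> l > 0" using \<gamma>[of l] by (cases "\<gamma> l = 0") auto
    then have "l = k"
      using l point[OF l(1)] point_market_apply[OF v l(1) k] by (auto split: if_splits)
    then show "point_market K v k \<in> optimal_markets K v \<beta> k"
      using opt[OF l(1) \<open>\<gamma> l > 0\<close>] point[OF l(1) \<open>\<gamma> l > 0\<close>] by simp
  qed
next
  assume opt: "\<forall>k\<in>{1..K}. xs (v k) > 0 \<longrightarrow> point_market K v k \<in> optimal_markets K v \<beta> k"
  have le1: "xs (v k) \<le> 1" if "k \<in> {1..K}" for k
    using member_le_sum[of k "{1..K}" "\<lambda>k. xs (v k)"] marketsD[OF v xs] that by auto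
  have agg: "(\<Sum>k=1..K. xs (v k) * point_market K v k w) = xs w" if w: "w \<in> value_set K v" for w
  proof -
    obtain i where i: "i \<in> {1..K}" "w = v i" using w by (auto simp: value_set_def)
    have "(\<Sum>k=1..K. xs (v k) * point_market K v k w) = (\<Sum>k=1..K. if k = i then xs w else 0)"
      using i point_market_apply[OF v] by (intro sum.cong) auto
    then show ?thesis using i by simp
  qed
  have C: "0 = (\<Sum>k=1..K. xs (v k) * consumer_utility K v (v k) (point_market K v k))"
    using consumer_utility_point_market[OF v] by simp
  have P: "(\<Sum>k=1..K. xs (v k) * v k) =
      (\<Sum>k=1..K. xs (v k) * producer_utility K v (v k) (point_market K v k))"
    using producer_utility_point_market[OF v] by simp
  show "(0, \<Sum>k=1..K. xs (v k) * v k) \<in> attainable_utilities K v xs \<beta>"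
    unfolding attainable_utilities_def mem_Collect_eq
  \<comment> \<open>Witness: complete segmentation by value, each segment weighted by the aggregate
    mass of its value.\<close>
  proof (intro exI[of _ "\<lambda>k. xs (v k)"] exI[of _ "point_market K v"] conjI)
    show "(0, \<Sum>k=1..K. xs (v k) * v k) =
        (\<Sum>k=1..K. xs (v k) * consumer_utility K v (v k) (point_market K v k),
         \<Sum>k=1..K. xs (v k) * producer_utility K v (v k) (point_market K v k))"
      by (simp only: C[symmetric] P[symmetric])
    show "\<forall>k\<in>{1..K}. xs (v k) \<in> {0..1}"
      using le1 marketsD(1)[OF v xs] by simp
    show "\<forall>w\<in>value_set K v. (\<Sum>k=1..K. xs (v k) * point_market K v k w) = xs w"
      using agg by blast
  qed (rule marketsD(2)[OF v xs] opt)+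
qed

theorem corollary2:
  fixes K :: nat and v :: "nat \<Rightarrow> real" and xs :: "real \<Rightarrow> real" and \<beta> :: real
  assumes "K \<ge> 2"
    and "0 < v 1"
    and "strict_mono_on {1..K} v"
    and "xs \<in> markets K v"
    and "\<beta> \<in> {0..1}"
  shows "(0, \<Sum>k=1..K. xs (v k) * v k) \<in> attainable_utilities K v xs \<beta> \<longleftrightarrow>
         \<beta> \<le> Min (threshold K v ` {k \<in> {1..K}. xs (v k) > 0})"
proof -
  have K: "K \<ge> 1" using assms(1) by simp
  \<comment> \<open>\<open>Min\<close> is characterised only on nonempty sets; the support is
    nonempty because the total mass is 1.\<close>
  have "{k \<in> {1..K}. xs (v k) > 0} \<noteq> {}"
  proof
    assume "{k \<in> {1..K}. xs (v k) > 0} = {}"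
    then have "(\<Sum>k=1..K. xs (v k)) \<le> 0"
      by (intro sum_nonpos) (auto simp: not_less)
    then show False using marketsD(2)[OF assms(3,4)] by simp
  qed
  then have "\<beta> \<le> Min (threshold K v ` {k \<in> {1..K}. xs (v k) > 0}) \<longleftrightarrow>
      (\<forall>k\<in>{1..K}. xs (v k) > 0 \<longrightarrow> \<beta> \<le> threshold K v k)"
    by (subst Min_ge_iff) auto
  also have "\<dots> \<longleftrightarrow> (\<forall>k\<in>{1..K}. xs (v k) > 0 \<longrightarrow> point_market K v k \<in> optimal_markets K v \<beta> k)"
    using point_market_optimal_iff[OF K assms(2,3,5)] by simp
  finally show ?thesis
    using full_extraction_attainable_iff[OF K assms(2-4)] by simp
qed

end
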